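(* Let $f:\mathbb{N}\to\mathbb{N}$, let $p$ be a prime, and let $n=\sum_{i=0}^t n_ip^i$ and $k=\sum_{j=0}^r k_jp^j$, where $n_i,k_j$ are integers with $0\le n_i,k_j<p$. Then $$\binom{k}{n}_{f} \equiv \sum_{(s_0,\ldots,s_r)}\prod_{i=0}^r \binom{k_i}{s_i}_{f}\pmod{p},$$ where the sum is over all tuples $(s_0,\ldots,s_r)$ of nonnegative integers that satisfy $s_0+s_1p+\cdots+s_rp^r=n$.
   Context: $\mathbb{N}=\{0,1,2,\dots\}$. For a function $f:\mathbb{N}\to\mathbb{N}$ and integers $k,n\ge 0$, the extended binomial coefficient $\binom{k}{n}_{f}$ is the coefficient of $x^n$ in the formal power series $\bigl(\sum_{s\in\mathbb{N}} f(s)x^s\bigr)^k$. *)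

theory Defs
  imports "HOL-Computational_Algebra.Computational_Algebra" "HOL-Number_Theory.Cong" "HOL-Library.FuncSet"
begin

definition ext_binom :: "(nat \<Rightarrow> nat) \<Rightarrow> nat \<Rightarrow> nat \<Rightarrow> nat" where
  "ext_binom f k n = fps_nth (Abs_fps f ^ k) n"

text \<open>Tuples \<open>(s\<^sub>0, \<dots>, s\<^sub>r)\<close> are extensional functions on \<open>{..r}\<close>, so that each tuple
  is represented exactly once.\<close>

definition weighted_tuples :: "nat \<Rightarrow> nat \<Rightarrow> nat \<Rightarrow> (nat \<Rightarrow> nat) set" where
  "weighted_tuples p r n = {s \<in> {..r} \<rightarrow>\<^sub>E UNIV. (\<Sum>i\<le>r. s i * p ^ i) = n}"

text \<open>A sum over an infinite set is \<open>0\<close> by convention; the following excludes this case.\<close>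

lemma finite_weighted_tuples:
  assumes "p > 0"
  shows "finite (weighted_tuples p r n)"
proof (rule finite_subset)
  show "weighted_tuples p r n \<subseteq> {..r} \<rightarrow>\<^sub>E {..n}"
  proof
    fix s assume s: "s \<in> weighted_tuples p r n"
    have "s i \<le> n" if "i \<le> r" for i
    proof -
      have "s i \<le> s i * p ^ i" using assms by simp
      also have "\<dots> \<le> (\<Sum>i\<le>r. s i * p ^ i)"
        using that by (intro member_le_sum) auto
      finally show ?thesis using s by (simp add: weighted_tuples_def)
    qed
    with s show "s \<in> {..r} \<rightarrow>\<^sub>E {..n}"
      by (auto simp: weighted_tuples_def PiE_iff)
  qed
  show "finite ({..r} \<rightarrow>\<^sub>E {..n})" by (intro finite_PiE) auto
qed

end

theory Submission
  imports Defs
begin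

text \<open>Modulo \<open>p\<close>, the coefficient of \<open>x\<^sup>n\<close> in \<open>g\<^sup>p\<close> is that of \<open>g(x\<^sup>p)\<close>. Splitting off the
  lowest digit, \<open>k = k\<^sub>0 + p m\<close>, one has \<open>F\<^sup>k = (F\<^sup>m)\<^sup>p F\<^bsup>k\<^sub>0\<^esup>\<close>, so the coefficient of \<open>x\<^sup>n\<close> is
  a convolution of the one for \<open>k\<^sub>0\<close> with the one for \<open>m\<close>, and induction on the number of digits
  applies.\<close>

text \<open>The inner binomial coefficients are divisible by \<open>p\<close>. The error is an
  explicit multiple of \<open>p\<close>, so that one statement serves both numbers and power series
  over \<open>nat\<close>.\<close>

lemma power_prime_add_decomp:
  fixes a b :: "'a :: comm_semiring_1"
  assumes "prime p"
  obtains c where "(a + b) ^ p = a ^ p + b ^ p + of_nat p * c"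
proof -
  let ?t = "\<lambda>i. of_nat (p choose i) * a ^ i * b ^ (p - i)"
  have "{..p} = {0, p} \<union> {0<..<p}"
    by auto
  then have "(a + b) ^ p = sum ?t {0, p} + sum ?t {0<..<p}"
    by (simp only: binomial_ring, subst sum.union_disjoint) auto
  also have "sum ?t {0, p} = a ^ p + b ^ p"
    using prime_gt_0_nat[OF assms] by (simp add: add.commute)
  also have "sum ?t {0<..<p} = of_nat p * (\<Sum>i\<in>{0<..<p}. of_nat ((p choose i) div p) * a ^ i * b ^ (p - i))"
    unfolding sum_distrib_left
  proof (rule sum.cong)
    fix i assume "i \<in> {0<..<p}"
    then have "p dvd p choose i"
      using assms by (intro dvd_choose_prime) auto
    then have "(of_nat (p choose i) :: 'a) = of_nat p * of_nat ((p choose i) div p)"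
      by (metis dvd_mult_div_cancel of_nat_mult)
    then show "?t i = of_nat p * (of_nat ((p choose i) div p) * a ^ i * b ^ (p - i))"
      by (simp add: mult.assoc)
  qed simp
  finally show ?thesis
    by (rule that)
qed

text \<open>Fermat's little theorem, by induction on \<open>a\<close>: up to a multiple of
  \<open>p\<close>, the \<open>p\<close>-th power is additive.\<close>

lemma power_prime_cong:
  fixes a p :: nat
  assumes "prime p"
  shows "[a ^ p = a] (mod p)"
proof (induction a)
  case 0
  then show ?case using prime_gt_0_nat[OF assms] by (simp add: zero_power)
next
  case (Suc a)
  obtain c where "(a + 1) ^ p = a ^ p + 1 ^ p + of_nat p * c"
    using power_prime_add_decomp[OF assms] .
  then have "[Suc a ^ p = a ^ p + 1] (mod p)"
    by (simp add: cong_def)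
  also have "[a ^ p + 1 = Suc a] (mod p)"
    using cong_add[OF Suc cong_refl, of 1] by simp
  finally show ?case .
qed

text \<open>Writing \<open>g = c + x h\<close> with constant term \<open>c\<close> gives
  \<open>g ^ p\<close> congruent to \<open>c ^ p + x ^ p h ^ p\<close>. The induction passes from
  \<open>g\<close> and \<open>n\<close> to \<open>h\<close> and \<open>n - p\<close>, hence
  \<open>g\<close> must vary.\<close>

lemma fps_nth_power_prime_cong:
  fixes g :: "nat fps"
  assumes "prime p"
  shows "[(g ^ p) $ n = (if p dvd n then g $ (n div p) else 0)] (mod p)"
proof (induction n arbitrary: g rule: less_induct)
  case (less n)
  have p: "p > 0"
    using assms prime_gt_0_nat by blast
  define h where "h = fps_shift 1 g"
  have g: "g = fps_const (g $ 0) + h * fps_X"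
    by (rule fps_ext) (simp add: h_def)
  obtain c where "(fps_const (g $ 0) + h * fps_X) ^ p
      = fps_const (g $ 0) ^ p + (h * fps_X) ^ p + of_nat p * c"
    using power_prime_add_decomp[OF assms] .
  then have "g ^ p = fps_const ((g $ 0) ^ p) + h ^ p * fps_X ^ p + of_nat p * c"
    by (simp only: g[symmetric] fps_const_power power_mult_distrib)
  \<comment> \<open>Every coefficient of \<open>of_nat p * c\<close> is a multiple of
    \<open>p\<close>.\<close>
  then have step: "[(g ^ p) $ n = fps_const ((g $ 0) ^ p) $ n + (h ^ p * fps_X ^ p) $ n] (mod p)"
    by (simp add: cong_def)
  consider "n = 0" | "0 < n" "n < p" | "p \<le> n"
    by linarith
  then show ?case
  proof cases
    case 1
    then show ?thesis
      using power_prime_cong[OF assms, of "g $ 0"] by (simp add: fps_power_zeroth)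
  next
    \<comment> \<open>The constant series contributes only at 0 and the other summand only from
      \<open>p\<close> on; also \<open>p\<close> does not divide \<open>n\<close>.\<close>
    case 2
    then show ?thesis
      using step by (auto simp: fps_X_power_mult_right_nth dest: dvd_imp_le)
  next
    case 3
    then have "[(g ^ p) $ n = (h ^ p) $ (n - p)] (mod p)"
      using step p by (simp add: fps_X_power_mult_right_nth)
    also have "[(h ^ p) $ (n - p) = (if p dvd n - p then h $ ((n - p) div p) else 0)] (mod p)"
      using 3 p by (intro less) auto
    \<comment> \<open>The shift in \<open>h\<close> makes up for the quotient dropping by one:
      \<open>n div p = Suc ((n - p) div p)\<close>.\<close>
    also have "(if p dvd n - p then h $ ((n - p) div p) else 0) = (if p dvd n then g $ (n div p) else 0)"
      using 3 p by (simp add: h_def le_div_geq dvd_minus_self)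
    finally show ?thesis .
  qed
qed

lemma ext_binom_add_mult_cong:
  assumes "prime p"
  shows "[ext_binom f (k + p * m) n = (\<Sum>b | b * p \<le> n. ext_binom f k (n - b * p) * ext_binom f m b)] (mod p)"
proof -
  define F where "F = Abs_fps f"
  have p: "p > 0"
    using assms prime_gt_0_nat by blast
  have "ext_binom f (k + p * m) n = ((F ^ m) ^ p * F ^ k) $ n"
    by (simp add: ext_binom_def F_def power_add power_mult[symmetric] mult.commute)
  also have "\<dots> = (\<Sum>i=0..n. ((F ^ m) ^ p) $ i * (F ^ k) $ (n - i))"
    by (simp add: fps_mult_nth)
  also have "[\<dots> = (\<Sum>i=0..n. (if p dvd i then (F ^ m) $ (i div p) else 0) * (F ^ k) $ (n - i))] (mod p)"
    by (intro cong_sum cong_mult fps_nth_power_prime_cong assms cong_refl)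
  \<comment> \<open>Only the indices \<open>i = b * p\<close> survive.\<close>
  also have "(\<Sum>i=0..n. (if p dvd i then (F ^ m) $ (i div p) else 0) * (F ^ k) $ (n - i))
      = (\<Sum>i | i \<le> n \<and> p dvd i. (F ^ m) $ (i div p) * (F ^ k) $ (n - i))"
    by (rule sum.mono_neutral_cong_right) auto
  also have "\<dots> = (\<Sum>b | b * p \<le> n. ext_binom f k (n - b * p) * ext_binom f m b)"
    by (rule sum.reindex_bij_witness[of _ "\<lambda>b. b * p" "\<lambda>i. i div p"])
      (use p in \<open>auto simp: ext_binom_def F_def mult.commute\<close>)
  finally show ?thesis .
qed

lemma sum_weighted_tuples_0:
  "(\<Sum>s\<in>weighted_tuples p 0 n. \<Prod>i\<le>0. h i (s i)) = h 0 n"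
proof -
  have "weighted_tuples p 0 n = {\<lambda>i\<in>{0}. n}"
    by (auto simp: weighted_tuples_def PiE_def extensional_def)
  then show ?thesis
    by simp
qed

text \<open>Classify tuples by the weight \<open>b\<close> of their tail
  \<open>s \<circ> Suc\<close>: the first entry is then forced to be \<open>n - b * p\<close>, a
  true difference because \<open>b * p \<le> n\<close>.\<close>

lemma sum_weighted_tuples_Suc:
  fixes h :: "nat \<Rightarrow> nat \<Rightarrow> 'a :: comm_semiring_1"
  assumes "p > 0"
  shows "(\<Sum>s\<in>weighted_tuples p (Suc r) n. \<Prod>i\<le>Suc r. h i (s i))
    = (\<Sum>b | b * p \<le> n. h 0 (n - b * p) * (\<Sum>s\<in>weighted_tuples p r b. \<Prod>i\<le>r. h (Suc i) (s i)))"
proof -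
  have weight: "(\<Sum>i\<le>Suc r. s i * p ^ i) = s 0 + (\<Sum>i\<le>r. s (Suc i) * p ^ i) * p" for s :: "nat \<Rightarrow> nat"
    by (simp add: sum.atMost_Suc_shift sum_distrib_left sum_distrib_right algebra_simps del: sum.atMost_Suc)
  \<comment> \<open>Finiteness is what allows the sum over pairs to be split into an iterated
    sum.\<close>
  have fin: "finite {b. b * p \<le> n}"
  proof (rule finite_subset)
    show "{b. b * p \<le> n} \<subseteq> {..n}"
    proof
      fix b assume "b \<in> {b. b * p \<le> n}"
      moreover have "b \<le> b * p"
        using assms by simp
      ultimately show "b \<in> {..n}"
        unfolding mem_Collect_eq atMost_iff by (rule le_trans[rotated])
    qed
  qed simp
  have "(\<Sum>s\<in>weighted_tuples p (Suc r) n. \<Prod>i\<le>Suc r. h i (s i))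
      = (\<Sum>(b, s)\<in>(SIGMA b:{b. b * p \<le> n}. weighted_tuples p r b).
          h 0 (n - b * p) * (\<Prod>i\<le>r. h (Suc i) (s i)))"
  \<comment> \<open>A tuple goes to its tail together with the tail's weight; the inverse prepends
    the forced entry by \<open>case_nat\<close>. Both maps respect extensionality, as values beyond
    the last index are only shifted.\<close>
  proof (rule sum.reindex_bij_witness
      [of _ "\<lambda>(b, s). case_nat (n - b * p) s" "\<lambda>s. ((\<Sum>i\<le>r. s (Suc i) * p ^ i), s \<circ> Suc)"])
    fix s assume "s \<in> weighted_tuples p (Suc r) n"
    then have s: "s \<in> extensional {..Suc r}" "n = s 0 + (\<Sum>i\<le>r. s (Suc i) * p ^ i) * p"
      unfolding weighted_tuples_def by (auto simp only: weight PiE_iff mem_Collect_eq)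
    show "(case ((\<Sum>i\<le>r. s (Suc i) * p ^ i), s \<circ> Suc) of (b, s) \<Rightarrow> case_nat (n - b * p) s) = s"
      using s by (auto simp: fun_eq_iff split: nat.split)
    show "((\<Sum>i\<le>r. s (Suc i) * p ^ i), s \<circ> Suc) \<in> (SIGMA b:{b. b * p \<le> n}. weighted_tuples p r b)"
      using s by (auto simp: weighted_tuples_def PiE_iff extensional_def)
    show "(case ((\<Sum>i\<le>r. s (Suc i) * p ^ i), s \<circ> Suc) of (b, s) \<Rightarrow>
        h 0 (n - b * p) * (\<Prod>i\<le>r. h (Suc i) (s i))) = (\<Prod>i\<le>Suc r. h i (s i))"
      using s by (simp add: prod.atMost_Suc_shift del: prod.atMost_Suc)
  next
    fix x assume "x \<in> (SIGMA b:{b. b * p \<le> n}. weighted_tuples p r b)"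
    then obtain b s where x: "x = (b, s)" "b * p \<le> n" "s \<in> extensional {..r}" "(\<Sum>i\<le>r. s i * p ^ i) = b"
      by (auto simp: weighted_tuples_def PiE_iff)
    let ?s = "case x of (b, s) \<Rightarrow> case_nat (n - b * p) s"
    show "((\<Sum>i\<le>r. ?s (Suc i) * p ^ i), ?s \<circ> Suc) = x"
      using x by (auto simp: fun_eq_iff)
    have "(\<Sum>i\<le>Suc r. ?s i * p ^ i) = n"
      unfolding weight using x by simp
    then show "?s \<in> weighted_tuples p (Suc r) n"
      using x by (auto simp: weighted_tuples_def PiE_iff extensional_def split: nat.split simp del: sum.atMost_Suc)
  qed
  also have "\<dots> = (\<Sum>b | b * p \<le> n. \<Sum>s\<in>weighted_tuples p r b. h 0 (n - b * p) * (\<Prod>i\<le>r. h (Suc i) (s i)))"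
    using fin finite_weighted_tuples[OF assms] by (subst sum.Sigma) auto
  finally show ?thesis
    by (simp add: sum_distrib_left)
qed

lemma ext_binom_sum_powers_cong:
  assumes "prime p"
  shows "[ext_binom f (\<Sum>j\<le>r. kd j * p ^ j) n
    = (\<Sum>s\<in>weighted_tuples p r n. \<Prod>i\<le>r. ext_binom f (kd i) (s i))] (mod p)"
\<comment> \<open>The hypothesis is applied to the shifted digits \<open>kd (Suc j)\<close> and to
  every \<open>b\<close> with \<open>b * p \<le> n\<close>, so \<open>kd\<close> and
  \<open>n\<close> must vary.\<close>
proof (induction r arbitrary: kd n)
  case 0
  then show ?case
    using sum_weighted_tuples_0[of "\<lambda>i. ext_binom f (kd i)" p n] by simp
next
  case (Suc r)
  define m where "m = (\<Sum>j\<le>r. kd (Suc j) * p ^ j)"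
  have "(\<Sum>j\<le>Suc r. kd j * p ^ j) = kd 0 + p * m"
    by (simp add: m_def sum.atMost_Suc_shift sum_distrib_left algebra_simps del: sum.atMost_Suc)
  then have "[ext_binom f (\<Sum>j\<le>Suc r. kd j * p ^ j) n
      = (\<Sum>b | b * p \<le> n. ext_binom f (kd 0) (n - b * p) * ext_binom f m b)] (mod p)"
    using ext_binom_add_mult_cong[OF assms] by simp
  also have "[(\<Sum>b | b * p \<le> n. ext_binom f (kd 0) (n - b * p) * ext_binom f m b)
      = (\<Sum>b | b * p \<le> n. ext_binom f (kd 0) (n - b * p) *
      (\<Sum>s\<in>weighted_tuples p r b. \<Prod>i\<le>r. ext_binom f (kd (Suc i)) (s i)))] (mod p)"
    unfolding m_def by (intro cong_sum cong_mult cong_refl Suc)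
  finally show ?case
    using sum_weighted_tuples_Suc[OF prime_gt_0_nat[OF assms], of "\<lambda>i. ext_binom f (kd i)" r n] by simp
qed

theorem theorem21:
  fixes f :: "nat \<Rightarrow> nat" and p n k t r :: nat and nd kd :: "nat \<Rightarrow> nat"
  assumes "prime p"
    and "n = (\<Sum>i\<le>t. nd i * p ^ i)" and "\<And>i. i \<le> t \<Longrightarrow> nd i < p"
    and "k = (\<Sum>j\<le>r. kd j * p ^ j)" and "\<And>j. j \<le> r \<Longrightarrow> kd j < p"
  shows "[ext_binom f k n = (\<Sum>s\<in>weighted_tuples p r n. \<Prod>i\<le>r. ext_binom f (kd i) (s i))] (mod p)"
  using ext_binom_sum_powers_cong[OF assms(1)] assms(4) by simp

end
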